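(* Let $\underline Q$ be an arbitrary lower transition rate operator and let $L_t^s$ ($0\le t\le s$) be the lower transition operators corresponding to $\underline Q$. Then for all $t,s\in\mathbb R_{\ge0}$ such that $t\le s$, $L_t^s=L_0^{s-t}$.
   Context: $\mathcal X$ is a fixed finite non-empty set; $\mathcal L(\mathcal X)$ is the set of all $f:\mathcal X\to\mathbb R$, with $\|f\|=\max_x|f(x)|$; inequalities between functions are pointwise. A non-negatively homogeneous operator $A:\mathcal L(\mathcal X)\to\mathcal L(\mathcal X)$ has norm $\|A\|=\sup\{\|Af\|:\|f\|=1\}$. $I$ is the identity. A lower transition rate operator is a map $\underline Q:\mathcal L(\mathcal X)\to\mathcal L(\mathcal X)$ such that for all $f,g\in\mathcal L(\mathcal X)$, $\lambda\ge0$, constant functions $\mu$ and $x,y\in\mathcal X$: $[\underline Q\mu](x)=0$; $[\underline Q\mathbb I_y](x)\ge0$ if $x\ne y$; $\underline Q(f+g)\ge\underline Qf+\underline Qg$; $\underline Q(\lambda f)=\lambda\underline Qf$. A lower transition operator is a map $\underline T:\mathcal L(\mathcal X)\to\mathcal L(\mathcal X)$ with $[\underline Tf](x)\ge\min f$, $\underline T(f+g)\ge\underline Tf+\underline Tg$ and $\underline T(\lambda f)=\lambda\underline Tf$ for $\lambda\ge0$. For $t\le s$, $\mathcal U_{[t,s]}$ is the set of finite sequences $u:\ t=t_0<t_1<\dots<t_n=s$; $\Delta_i=t_i-t_{i-1}$, $\sigma(u)=\max_i\Delta_i$ ($0$ if $n=0$), $\Phi_u=(I+\Delta_1\underline Q)\cdots(I+\Delta_n\underline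 Q)$ (composition; $I$ if $n=0$). The lower transition operator $L_t^s$ corresponding to $\underline Q$ is the (existing, unique) lower transition operator such that for every $\epsilon>0$ there is $\delta>0$ with $\|L_t^s-\Phi_u\|\le\epsilon$ for all $u\in\mathcal U_{[t,s]}$ with $\sigma(u)\le\delta$. *)

theory Defs
  imports "HOL-Analysis.Analysis"
begin

text \<open>The finite non-empty set of states is the universe of a type \<open>'x\<close> of class \<^class>\<open>finite\<close>;
  the space of all real-valued functions on it is the type \<open>'x \<Rightarrow> real\<close>.\<close>

definition fun_norm :: "('x::finite \<Rightarrow> real) \<Rightarrow> real" where
  "fun_norm f = Max (range (\<lambda>x. \<bar>f x\<bar>))"

text \<open>The supremum is taken in \<^typ>\<open>real\<close>, so it is meaningful only for operators that are bounded on
  the unit sphere. This covers all differences of lower transition operators and finite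
  compositions of operators of the form \<open>I + \<Delta>Q\<close>, to which it is applied below.\<close>

definition op_norm :: "(('x::finite \<Rightarrow> real) \<Rightarrow> ('x \<Rightarrow> real)) \<Rightarrow> real" where
  "op_norm A = Sup {fun_norm (A f) | f. fun_norm f = 1}"

definition lower_transition_rate_operator ::
    "(('x::finite \<Rightarrow> real) \<Rightarrow> ('x \<Rightarrow> real)) \<Rightarrow> bool" where
  "lower_transition_rate_operator Q \<longleftrightarrow>
     (\<forall>c x. Q (\<lambda>_. c) x = 0) \<and>
     (\<forall>x y. x \<noteq> y \<longrightarrow> Q (indicator {y}) x \<ge> 0) \<and>
     (\<forall>f g x. Q (\<lambda>z. f z + g z) x \<ge> Q f x + Q g x) \<and>
     (\<forall>f r x. r \<ge> 0 \<longrightarrow> Q (\<lambda>z. r * f z) x = r * Q f x)"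

definition lower_transition_operator ::
    "(('x::finite \<Rightarrow> real) \<Rightarrow> ('x \<Rightarrow> real)) \<Rightarrow> bool" where
  "lower_transition_operator T \<longleftrightarrow>
     (\<forall>f x. T f x \<ge> Min (range f)) \<and>
     (\<forall>f g x. T (\<lambda>z. f z + g z) x \<ge> T f x + T g x) \<and>
     (\<forall>f r x. r \<ge> 0 \<longrightarrow> T (\<lambda>z. r * f z) x = r * T f x)"

text \<open>A sequence \<open>t = t\<^sub>0 < t\<^sub>1 < \<dots> < t\<^sub>n = s\<close> is the list \<open>[t\<^sub>0, \<dots>, t\<^sub>n]\<close> of length
  \<open>n + 1\<close>; for \<open>t = s\<close> the only such list is \<open>[t]\<close>, with \<open>n = 0\<close>.\<close>

definition partitions :: "real \<Rightarrow> real \<Rightarrow> real list set" where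
  "partitions t s = {u. u \<noteq> [] \<and> hd u = t \<and> last u = s \<and> sorted_wrt (<) u}"

definition mesh :: "real list \<Rightarrow> real" where
  "mesh u = (if length u \<le> 1 then 0
             else Max {u ! Suc i - u ! i | i. Suc i < length u})"

definition euler_step ::
    "(('x::finite \<Rightarrow> real) \<Rightarrow> ('x \<Rightarrow> real)) \<Rightarrow> real \<Rightarrow> ('x \<Rightarrow> real) \<Rightarrow> ('x \<Rightarrow> real)" where
  "euler_step Q d f = (\<lambda>x. f x + d * Q f x)"

fun Phi :: "(('x::finite \<Rightarrow> real) \<Rightarrow> ('x \<Rightarrow> real)) \<Rightarrow> real list \<Rightarrow> ('x \<Rightarrow> real) \<Rightarrow> ('x \<Rightarrow> real)" where
  "Phi Q (a # b # u) = euler_step Q (b - a) \<circ> Phi Q (b # u)"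
| "Phi Q [a] = id"
| "Phi Q [] = id"

definition corresponding_operator ::
    "(('x::finite \<Rightarrow> real) \<Rightarrow> ('x \<Rightarrow> real)) \<Rightarrow> real \<Rightarrow> real
       \<Rightarrow> (('x \<Rightarrow> real) \<Rightarrow> ('x \<Rightarrow> real)) \<Rightarrow> bool" where
  "corresponding_operator Q t s T \<longleftrightarrow>
     lower_transition_operator T \<and>
     (\<forall>\<epsilon>>0. \<exists>\<delta>>0. \<forall>u\<in>partitions t s. mesh u \<le> \<delta> \<longrightarrow>
        op_norm (\<lambda>f x. T f x - Phi Q u f x) \<le> \<epsilon>)"

text \<open>For a lower transition rate operator \<open>Q\<close> and \<open>t \<le> s\<close>, there is exactly one operator
  described here; for other arguments the value is unspecified.\<close>

definition L :: "(('x::finite \<Rightarrow> real) \<Rightarrow> ('x \<Rightarrow> real)) \<Rightarrow> real \<Rightarrow> real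
    \<Rightarrow> ('x \<Rightarrow> real) \<Rightarrow> ('x \<Rightarrow> real)" where
  "L Q t s = (THE T. corresponding_operator Q t s T)"

end

theory Submission
  imports Defs
begin

text \<open>The rate operator does not depend on time, so \<open>\<Phi>\<^sub>u\<close> and \<open>\<sigma>(u)\<close> depend only on the increments of
  \<open>u\<close>. Translating partitions by \<open>-t\<close> therefore turns the property that characterises \<open>L\<^sub>t\<^sup>s\<close> into the
  one that characterises \<open>L\<^sub>0\<^sup>s\<^sup>-\<^sup>t\<close>, without any appeal to existence or uniqueness.\<close>

lemma Phi_translate: "Phi Q (map (\<lambda>x. x + c) u) = Phi Q u"
  by (induction Q u rule: Phi.induct) auto

lemma mesh_translate: "mesh (map (\<lambda>x. x + c) u) = mesh u"
proof -
  \<comment> \<open>The bound \<open>Suc i < length u\<close> lets both entries pass through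
    \<open>map\<close>; then \<open>c\<close> cancels.\<close>
  have "{map (\<lambda>x. x + c) u ! Suc i - map (\<lambda>x. x + c) u ! i | i. Suc i < length u} =
        {u ! Suc i - u ! i | i. Suc i < length u}"
    by (intro Collect_cong ex_cong1) auto
  then show ?thesis
    unfolding mesh_def by (simp only: length_map)
qed

lemma partitions_translate:
  "u \<in> partitions t s \<Longrightarrow> map (\<lambda>x. x + c) u \<in> partitions (t + c) (s + c)"
  by (auto simp: partitions_def hd_map last_map sorted_wrt_map)

text \<open>Since \<open>c\<close> may have either sign, this one implication also yields its
  converse.\<close>

lemma corresponding_operator_translate:
  assumes "corresponding_operator Q t s T"
  shows "corresponding_operator Q (t + c) (s + c) T"
  unfolding corresponding_operator_def
proof (intro conjI allI impI)
  show "lower_transition_operator T"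
    using assms by (simp add: corresponding_operator_def)
next
  fix \<epsilon> :: real
  assume "\<epsilon> > 0"
  then obtain \<delta> where "\<delta> > 0" and \<delta>: "\<And>u. u \<in> partitions t s \<Longrightarrow> mesh u \<le> \<delta> \<Longrightarrow>
      op_norm (\<lambda>f x. T f x - Phi Q u f x) \<le> \<epsilon>"
    using assms unfolding corresponding_operator_def by blast
  have "op_norm (\<lambda>f x. T f x - Phi Q u f x) \<le> \<epsilon>"
    if "u \<in> partitions (t + c) (s + c)" and "mesh u \<le> \<delta>" for u
  proof -
    \<comment> \<open>Shifting back by \<open>- c\<close> lands in the original interval, so its
      \<delta> serves unchanged.\<close>
    have "map (\<lambda>x. x + - c) u \<in> partitions t s"
      using partitions_translate[OF that(1), of "- c"] by simp
    moreover have "mesh (map (\<lambda>x. x + - c) u) \<le> \<delta>"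
      using that(2) by (simp only: mesh_translate)
    ultimately show ?thesis
      using \<delta>[of "map (\<lambda>x. x + - c) u"] by (simp only: Phi_translate)
  qed
  with \<open>\<delta> > 0\<close> show "\<exists>\<delta>>0. \<forall>u\<in>partitions (t + c) (s + c). mesh u \<le> \<delta> \<longrightarrow>
      op_norm (\<lambda>f x. T f x - Phi Q u f x) \<le> \<epsilon>"
    by blast
qed

theorem proposition7p14:
  fixes Q :: "('x::finite \<Rightarrow> real) \<Rightarrow> ('x \<Rightarrow> real)"
    and t s :: real
  assumes "lower_transition_rate_operator Q"
    and "0 \<le> t" and "0 \<le> s" and "t \<le> s"
  shows "L Q t s = L Q 0 (s - t)"
proof -
  \<comment> \<open>Shifts by \<open>- t\<close> and by \<open>t\<close> give the two directions;
    both \<open>THE\<close> terms then range over the same predicate.\<close>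
  have "corresponding_operator Q t s T \<longleftrightarrow> corresponding_operator Q 0 (s - t) T" for T
    using corresponding_operator_translate[of Q t s T "- t"]
      corresponding_operator_translate[of Q 0 "s - t" T t]
    by auto
  then show ?thesis
    by (simp add: L_def)
qed

end
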